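(* Let $0<p\leq 1$ and let $\mathcal{B}=(\mathbf{x}_n)_{n\in\mathbb{N}}$ be a semi-normalized Markushevich basis, with dual basis $(\mathbf{x}_n^* )_{n\in\mathbb{N}}$, in a $p$-Banach space $\mathbb{X}$. Let $$\mathbb{A}:=\{x\in\mathbb{X} : |\mathbf{x}_n^*(x)|\neq|\mathbf{x}_j^*(x)| \text{ for all } n\neq j,\ n,j\in\operatorname{supp}(x)\}.$$ The following are equivalent: 1) $\mathcal{B}$ is almost-greedy, i.e. there is a constant $C>0$ such that for every $x\in\mathbb{X}$ and every finite greedy set $A$ of $x$, $$\Vert x-P_A(x)\Vert\leq C\inf_{|B|\leq|A|}\Vert x-P_B(x)\Vert.$$ 2) $\mathcal{B}$ is almost-greedy for elements $x\in\mathbb{A}$, i.e. there is a constant $C>0$ such that for every $x\in\mathbb{A}$ and every finite greedy set $A$ of $x$, $$\Vert x-P_A(x)\Vert\leq C\inf_{|B|\leq|A|}\Vert x-P_B(x)\Vert.$$ 3) $\mathcal{B}$ is quasi-greedy and democratic.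
   Context: Let $\mathbb{F}=\mathbb{R}$ or $\mathbb{C}$. For $0<p\le 1$, a $p$-Banach space is a vector space $\mathbb{X}$ over $\mathbb{F}$ with a map $\|\cdot\|:\mathbb{X}\to[0,\infty)$ such that $\|x\|=0$ iff $x=0$, $\|\alpha x\|=|\alpha|\|x\|$ for all scalars $\alpha$, and $\|x+y\|^p\le\|x\|^p+\|y\|^p$, which is complete for the metric $\|x-y\|^p$. $\mathbb{X}^*$ is the space of continuous linear functionals on $\mathbb{X}$, with $\|x^*\|=\sup_{\|x\|\le1}|x^*(x)|$. A sequence $\mathcal{B}=(\mathbf{x}_n)_{n\in\mathbb{N}}$ in $\mathbb{X}$ is a Markushevich basis with dual basis $(\mathbf{x}_n^* )_{n\in\mathbb{N}}\subset\mathbb{X}^*$ if $\mathbf{x}_n^*(\mathbf{x}_m)=\delta_{n,m}$ for all $n,m$, the linear span of $(\mathbf{x}_n)$ is dense in $\mathbb{X}$, and the linear span of $(\mathbf{x}_n^* )$ is weak*-dense in $\mathbb{X}^*$. It is semi-normalized if there are constants $\mathbf{c}_1,\mathbf{c}_2$ with $$0<\mathbf{c}_1\leq\inf_n\min\{\|\mathbf{x}_n\|,\|\mathbf{x}_n^*\|\}\leq\sup_n\max\{\|\mathbf{x}_n\|,\|\mathbf{x}_n^*\|\}\leq\mathbf{c}_2<\infty.$$ For $x\in\mathbb{X}$, $\operatorname{supp}(x):=\{n\in\mathbb{N}:\mathbf{x}_n^*(x)\neq0\}$. For a finite set $A\subset\mathbb{N}$, $|A|$ is its cardinality, $P_A(x):=\sum_{n\in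 A}\mathbf{x}_n^*(x)\mathbf{x}_n$ and $\mathbf{1}_A:=\sum_{n\in A}\mathbf{x}_n$. Infima over $|B|\le|A|$ run over finite sets $B\subset\mathbb{N}$ (including $B=\emptyset$). A finite set $A\subset\mathbb{N}$ is a greedy set of $x$ if $\min_{n\in A}|\mathbf{x}_n^*(x)|\geq\max_{n\notin A}|\mathbf{x}_n^*(x)|$. $\mathcal{B}$ is quasi-greedy if there is $C>0$ such that $\|x-P_A(x)\|\leq C\|x\|$ for every $x\in\mathbb{X}$ and every finite greedy set $A$ of $x$. $\mathcal{B}$ is democratic if there is $C>0$ such that $\|\mathbf{1}_A\|\leq C\|\mathbf{1}_B\|$ for every pair of finite sets $A,B\subset\mathbb{N}$ with $|A|\leq|B|$. *)

theory Defs
  imports "HOL-Analysis.Analysis" "HOL-Library.Function_Algebras"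
begin

text \<open>
  The scalar field: normed fields that are, up to isometric isomorphism over the reals,
  the reals or the complex numbers.
\<close>

class real_or_complex = real_normed_field +
  assumes real_or_complex:
    "(\<forall>z. \<exists>a. z = a *\<^sub>R 1) \<or>
     (\<exists>i. i * i = - 1 \<and>
        (\<forall>z. \<exists>a b. z = a *\<^sub>R 1 + b *\<^sub>R i \<and> norm z = sqrt (a\<^sup>2 + b\<^sup>2)))"

instance real :: real_or_complex
  by standard simp

instance complex :: real_or_complex
proof
  have "\<i> * \<i> = (- 1 :: complex) \<and>
    (\<forall>z. \<exists>a b. z = a *\<^sub>R 1 + b *\<^sub>R \<i> \<and> norm z = sqrt (a\<^sup>2 + b\<^sup>2))"
    by (auto simp: complex_eq_iff cmod_def)
  then show "(\<forall>z::complex. \<exists>a. z = a *\<^sub>R 1) \<or>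
     (\<exists>i::complex. i * i = - 1 \<and>
        (\<forall>z. \<exists>a b. z = a *\<^sub>R 1 + b *\<^sub>R i \<and> norm z = sqrt (a\<^sup>2 + b\<^sup>2)))"
    by blast
qed


subsection \<open>p-Banach spaces and their duals\<close>

definition p_dist :: "real \<Rightarrow> ('x::ab_group_add \<Rightarrow> real) \<Rightarrow> 'x \<Rightarrow> 'x \<Rightarrow> real" where
  "p_dist p nrm x y = nrm (x - y) powr p"

locale p_banach_space =
  vector_space smul
  for smul :: "'k::real_or_complex \<Rightarrow> 'x::ab_group_add \<Rightarrow> 'x" +
  fixes p :: real and nrm :: "'x \<Rightarrow> real"
  assumes p_pos: "0 < p" and p_le_1: "p \<le> 1"
    and nrm_nonneg: "0 \<le> nrm x"
    and nrm_eq_0_iff: "nrm x = 0 \<longleftrightarrow> x = 0"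
    and nrm_scale: "nrm (smul a x) = norm a * nrm x"
    and nrm_powr_add_le: "nrm (x + y) powr p \<le> nrm x powr p + nrm y powr p"
    and complete: "Metric_space.mcomplete UNIV (p_dist p nrm)"

sublocale p_banach_space \<subseteq> Metric_space UNIV "p_dist p nrm"
proof
  fix x y z :: 'x
  have "nrm (- u) = nrm u" for u
    using nrm_scale[of "- 1" u] by (simp add: scale_minus_left)
  from this[of "x - y"] show "p_dist p nrm x y = p_dist p nrm y x"
    by (simp add: p_dist_def)
  show "0 \<le> p_dist p nrm x y"
    by (simp add: p_dist_def)
  show "p_dist p nrm x y = 0 \<longleftrightarrow> x = y"
    by (simp add: p_dist_def nrm_eq_0_iff)
  show "p_dist p nrm x z \<le> p_dist p nrm x y + p_dist p nrm y z"
    using nrm_powr_add_le[of "x - y" "y - z"] by (simp add: p_dist_def)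
qed

definition p_topology :: "real \<Rightarrow> ('x::ab_group_add \<Rightarrow> real) \<Rightarrow> 'x topology" where
  "p_topology p nrm = Metric_space.mtopology UNIV (p_dist p nrm)"

definition dual_space ::
    "('k::real_or_complex \<Rightarrow> 'x::ab_group_add \<Rightarrow> 'x) \<Rightarrow> real \<Rightarrow> ('x \<Rightarrow> real) \<Rightarrow> ('x \<Rightarrow> 'k) set" where
  "dual_space smul p nrm =
     {f. Vector_Spaces.linear smul (*) f \<and> continuous_map (p_topology p nrm) euclidean f}"

text \<open>For \<open>f\<close> in the dual space the supremum is over a nonempty bounded set of reals.\<close>

definition dual_norm :: "('x \<Rightarrow> real) \<Rightarrow> ('x \<Rightarrow> 'k::real_or_complex) \<Rightarrow> real" where
  "dual_norm nrm f = (SUP x\<in>{x. nrm x \<le> 1}. norm (f x))"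

text \<open>The weak* topology is the topology of pointwise convergence.\<close>

definition weak_star_topology ::
    "('k::real_or_complex \<Rightarrow> 'x::ab_group_add \<Rightarrow> 'x) \<Rightarrow> real \<Rightarrow> ('x \<Rightarrow> real) \<Rightarrow> ('x \<Rightarrow> 'k) topology" where
  "weak_star_topology smul p nrm =
     subtopology (product_topology (\<lambda>_. euclidean) UNIV) (dual_space smul p nrm)"



lemma vector_space_functionals:
  "vector_space (\<lambda>c (f :: 'x \<Rightarrow> 'k::real_or_complex) x. c * f x)"
  by standard (auto simp: fun_eq_iff algebra_simps)


subsection \<open>Markushevich bases\<close>

definition markushevich_basis ::
    "('k::real_or_complex \<Rightarrow> 'x::ab_group_add \<Rightarrow> 'x) \<Rightarrow> real \<Rightarrow> ('x \<Rightarrow> real) \<Rightarrow>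
     (nat \<Rightarrow> 'x) \<Rightarrow> (nat \<Rightarrow> 'x \<Rightarrow> 'k) \<Rightarrow> bool" where
  "markushevich_basis smul p nrm b b' \<longleftrightarrow>
     (\<forall>n. b' n \<in> dual_space smul p nrm) \<and>
     (\<forall>n m. b' n (b m) = (if n = m then 1 else 0)) \<and>
     p_topology p nrm closure_of (module.span smul (range b)) = UNIV \<and>
     weak_star_topology smul p nrm closure_of (module.span (\<lambda>c f x. c * f x) (range b'))
       = dual_space smul p nrm"

definition semi_normalized ::
    "('x \<Rightarrow> real) \<Rightarrow> (nat \<Rightarrow> 'x) \<Rightarrow> (nat \<Rightarrow> 'x \<Rightarrow> 'k::real_or_complex) \<Rightarrow> bool" where
  "semi_normalized nrm b b' \<longleftrightarrow>
     (\<exists>c1 c2. 0 < c1 \<and>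
        (\<forall>n. c1 \<le> min (nrm (b n)) (dual_norm nrm (b' n)) \<and>
             max (nrm (b n)) (dual_norm nrm (b' n)) \<le> c2))"

definition supp :: "(nat \<Rightarrow> 'x \<Rightarrow> 'k::real_or_complex) \<Rightarrow> 'x \<Rightarrow> nat set" where
  "supp b' x = {n. b' n x \<noteq> 0}"

definition proj ::
    "('k::real_or_complex \<Rightarrow> 'x::ab_group_add \<Rightarrow> 'x) \<Rightarrow> (nat \<Rightarrow> 'x) \<Rightarrow> (nat \<Rightarrow> 'x \<Rightarrow> 'k) \<Rightarrow>
     nat set \<Rightarrow> 'x \<Rightarrow> 'x" where
  "proj smul b b' A x = (\<Sum>n\<in>A. smul (b' n x) (b n))"

definition indicator_sum :: "(nat \<Rightarrow> 'x::ab_group_add) \<Rightarrow> nat set \<Rightarrow> 'x" where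
  "indicator_sum b A = (\<Sum>n\<in>A. b n)"


subsection \<open>Greedy sets and greedy-type bases\<close>

text \<open>The empty set is a greedy set of every vector.\<close>

definition greedy_set :: "(nat \<Rightarrow> 'x \<Rightarrow> 'k::real_or_complex) \<Rightarrow> 'x \<Rightarrow> nat set \<Rightarrow> bool" where
  "greedy_set b' x A \<longleftrightarrow> finite A \<and> (\<forall>n\<in>A. \<forall>m. m \<notin> A \<longrightarrow> norm (b' m x) \<le> norm (b' n x))"

definition quasi_greedy ::
    "('k::real_or_complex \<Rightarrow> 'x::ab_group_add \<Rightarrow> 'x) \<Rightarrow> ('x \<Rightarrow> real) \<Rightarrow>
     (nat \<Rightarrow> 'x) \<Rightarrow> (nat \<Rightarrow> 'x \<Rightarrow> 'k) \<Rightarrow> bool" where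
  "quasi_greedy smul nrm b b' \<longleftrightarrow>
     (\<exists>C>0. \<forall>x A. greedy_set b' x A \<longrightarrow> nrm (x - proj smul b b' A x) \<le> C * nrm x)"

definition democratic :: "('x::ab_group_add \<Rightarrow> real) \<Rightarrow> (nat \<Rightarrow> 'x) \<Rightarrow> bool" where
  "democratic nrm b \<longleftrightarrow>
     (\<exists>C>0. \<forall>A B. finite A \<longrightarrow> finite B \<longrightarrow> card A \<le> card B \<longrightarrow>
        nrm (indicator_sum b A) \<le> C * nrm (indicator_sum b B))"

definition almost_greedy_on ::
    "'x set \<Rightarrow> ('k::real_or_complex \<Rightarrow> 'x::ab_group_add \<Rightarrow> 'x) \<Rightarrow> ('x \<Rightarrow> real) \<Rightarrow>
     (nat \<Rightarrow> 'x) \<Rightarrow> (nat \<Rightarrow> 'x \<Rightarrow> 'k) \<Rightarrow> bool" where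
  "almost_greedy_on S smul nrm b b' \<longleftrightarrow>
     (\<exists>C>0. \<forall>x\<in>S. \<forall>A. greedy_set b' x A \<longrightarrow>
        nrm (x - proj smul b b' A x)
          \<le> C * (INF B\<in>{B. finite B \<and> card B \<le> card A}. nrm (x - proj smul b b' B x)))"

abbreviation almost_greedy ::
    "('k::real_or_complex \<Rightarrow> 'x::ab_group_add \<Rightarrow> 'x) \<Rightarrow> ('x \<Rightarrow> real) \<Rightarrow>
     (nat \<Rightarrow> 'x) \<Rightarrow> (nat \<Rightarrow> 'x \<Rightarrow> 'k) \<Rightarrow> bool" where
  "almost_greedy \<equiv> almost_greedy_on UNIV"

definition distinct_moduli :: "(nat \<Rightarrow> 'x \<Rightarrow> 'k::real_or_complex) \<Rightarrow> 'x set" where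
  "distinct_moduli b' =
     {x. \<forall>n\<in>supp b' x. \<forall>j\<in>supp b' x. n \<noteq> j \<longrightarrow> norm (b' n x) \<noteq> norm (b' j x)}"

end

theory Submission
  imports Defs
begin

text \<open>
  Both sides of an almost-greedy inequality with a fixed competitor set \<open>B\<close> are continuous in \<open>x\<close>, and
  vectors with distinct moduli for which \<open>A\<close> is greedy accumulate at every \<open>x\<close> with greedy set \<open>A\<close>;
  hence 2) implies 1). That 1) implies 3) follows from \<open>B = {}\<close> and from comparing indicator sums of
  disjoint sets. For 3) implies 1) the crucial estimate is
  \<open>min\<^bsub>n\<in>A\<^esub> |x\<^sub>n\<^sup>*(x)| \<parallel>1\<^sub>A\<parallel> \<le> C \<parallel>x\<parallel>\<close> for greedy sets \<open>A\<close> of \<open>x\<close>. On a set of indices where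
  the coefficients are nearly constant, in modulus or in phase, the deviation is absorbed by
  \<open>p\<close>-convexity, and finitely many phase cells and a geometric progression of modulus levels cover \<open>A\<close>.
\<close>

section \<open>Scalars and real numbers\<close>

text \<open>One pair of real coordinates serves both scalar fields: over the reals
  \<open>u = 1\<close> with second coordinate \<open>0\<close>, otherwise \<open>u\<close> is the
  imaginary unit, whose norm is forced by \<open>i * i = - 1\<close>.\<close>

lemma real_or_complex_parts:
  obtains u :: "'k::real_or_complex" and S T :: "'k \<Rightarrow> real" where "norm u = 1"
    "\<And>z. z = of_real (S z) + of_real (T z) * u"
    "\<And>z. \<bar>S z\<bar> \<le> norm z" "\<And>z. \<bar>T z\<bar> \<le> norm z"
proof -
  have "\<exists>u :: 'k. norm u = 1 \<and>
    (\<forall>z. \<exists>s t. z = of_real s + of_real t * u \<and> \<bar>s\<bar> \<le> norm z \<and> \<bar>t\<bar> \<le> norm z)"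
  proof (cases "\<forall>z::'k. \<exists>a. z = a *\<^sub>R 1")
    case True
    have "\<exists>s t. z = of_real s + of_real t * 1 \<and> \<bar>s\<bar> \<le> norm z \<and> \<bar>t\<bar> \<le> norm z" for z :: 'k
    proof -
      obtain s where "z = of_real s" using True by (auto simp: of_real_def)
      then show ?thesis by (intro exI[of _ s] exI[of _ 0]) simp
    qed
    then show ?thesis by (intro exI[of _ 1]) simp
  next
    case False
    then obtain i :: 'k where i: "i * i = - 1"
      and parts: "\<And>z. \<exists>a b. z = a *\<^sub>R 1 + b *\<^sub>R i \<and> norm z = sqrt (a\<^sup>2 + b\<^sup>2)"
      using real_or_complex[where 'a='k] by blast
    have "norm i * norm i = 1"
      by (simp add: i flip: norm_mult)
    then have "norm i = 1"
      by (metis abs_norm_cancel abs_square_eq_1 power2_eq_square)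
    moreover have "\<exists>s t. z = of_real s + of_real t * i \<and> \<bar>s\<bar> \<le> norm z \<and> \<bar>t\<bar> \<le> norm z" for z
    proof -
      obtain s t where st: "z = s *\<^sub>R 1 + t *\<^sub>R i" "norm z = sqrt (s\<^sup>2 + t\<^sup>2)"
        using parts by blast
      have "\<bar>s\<bar> \<le> norm z" "\<bar>t\<bar> \<le> norm z"
        unfolding st(2) by (simp_all add: real_le_rsqrt)
      then show ?thesis
        using st(1) by (intro exI[of _ s] exI[of _ t]) (simp add: of_real_def)
    qed
    ultimately show ?thesis by blast
  qed
  then show ?thesis using that by metis
qed

text \<open>Total boundedness of the unit sphere, by a grid of mesh \<open>\<delta> / 2\<close> in
  the two real coordinates. A cell is the pair of integer parts after scaling by
  \<open>2 / \<delta>\<close>, so two scalars in one cell differ by at most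
  \<open>\<delta> / 2\<close> in each coordinate.\<close>

lemma finite_cells_unit_sphere:
  fixes \<delta> :: real
  assumes "\<delta> > 0"
  obtains cell :: "'k::real_or_complex \<Rightarrow> int \<times> int" and Z where "finite Z"
    "\<And>z. norm z = 1 \<Longrightarrow> cell z \<in> Z"
    "\<And>z w. cell z = cell w \<Longrightarrow> norm (z - w) \<le> \<delta>"
proof -
  obtain u :: 'k and S T where u: "norm u = 1"
    and ST: "\<And>z. z = of_real (S z) + of_real (T z) * u"
      "\<And>z. \<bar>S z\<bar> \<le> norm z" "\<And>z. \<bar>T z\<bar> \<le> norm z"
    by (rule real_or_complex_parts) (rule that)
  define k where "k = 2 / \<delta>"
  have k: "k > 0" using assms by (simp add: k_def)
  define cell where "cell z = (\<lfloor>k * S z\<rfloor>, \<lfloor>k * T z\<rfloor>)" for z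
  show ?thesis
  proof (rule that)
    show "finite ({\<lfloor>- k\<rfloor>..\<lfloor>k\<rfloor>} \<times> {\<lfloor>- k\<rfloor>..\<lfloor>k\<rfloor>})" by simp
  next
    fix z :: 'k assume "norm z = 1"
    then have "\<bar>S z\<bar> \<le> 1" "\<bar>T z\<bar> \<le> 1" using ST(2,3)[of z] by auto
    then have "\<bar>k * S z\<bar> \<le> k" "\<bar>k * T z\<bar> \<le> k"
      using k by (simp_all add: abs_mult mult_left_le)
    then have "- k \<le> k * S z" "k * S z \<le> k" "- k \<le> k * T z" "k * T z \<le> k"
      by linarith+
    then show "cell z \<in> {\<lfloor>- k\<rfloor>..\<lfloor>k\<rfloor>} \<times> {\<lfloor>- k\<rfloor>..\<lfloor>k\<rfloor>}"
      unfolding cell_def by (auto intro!: floor_mono)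
  next
    fix z w :: 'k assume "cell z = cell w"
    then have e: "\<lfloor>k * S z\<rfloor> = \<lfloor>k * S w\<rfloor>" "\<lfloor>k * T z\<rfloor> = \<lfloor>k * T w\<rfloor>"
      by (simp_all add: cell_def)
    have "\<bar>k * S z - k * S w\<bar> \<le> 1" "\<bar>k * T z - k * T w\<bar> \<le> 1"
      using e by linarith+
    then have "k * \<bar>S z - S w\<bar> \<le> 1" "k * \<bar>T z - T w\<bar> \<le> 1"
      using k by (simp_all add: abs_mult flip: right_diff_distrib)
    then have d: "\<bar>S z - S w\<bar> \<le> \<delta> / 2" "\<bar>T z - T w\<bar> \<le> \<delta> / 2"
      using assms by (simp_all add: k_def field_simps)
    have "z - w = of_real (S z - S w) + of_real (T z - T w) * u"
      by (subst ST(1)[of z], subst ST(1)[of w]) (simp add: algebra_simps)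
    then have "norm (z - w) \<le> \<bar>S z - S w\<bar> + \<bar>T z - T w\<bar>"
      using norm_triangle_ineq[of "of_real (S z - S w)" "of_real (T z - T w) * u"] u
      by (simp add: norm_mult del: of_real_diff)
    with d show "norm (z - w) \<le> \<delta>" by linarith
  qed
qed

lemma exists_powr_less:
  fixes p L \<eta> :: real
  assumes "0 < p" "0 \<le> L" "0 < \<eta>"
  obtains \<tau> where "\<tau> > 0" "L * \<tau> powr p < \<eta>"
proof
  \<comment> \<open>The summand \<open>1\<close> covers \<open>L = 0\<close> and makes the final
    inequality strict.\<close>
  show "(\<eta> / (L + 1)) powr (1 / p) > 0" using assms by simp
  have "((\<eta> / (L + 1)) powr (1 / p)) powr p = \<eta> / (L + 1)"
    using assms by (simp add: powr_powr)
  moreover have "L * (\<eta> / (L + 1)) < \<eta>"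
    using assms by (simp add: field_simps)
  ultimately show "L * ((\<eta> / (L + 1)) powr (1 / p)) powr p < \<eta>" by simp
qed

text \<open>Values are chosen one at a time: a nondegenerate interval is infinite and so contains a
  point avoiding the finitely many values already taken.\<close>

lemma injective_perturbation:
  fixes v :: "'a \<Rightarrow> real"
  assumes "finite F" "\<epsilon> > 0"
  shows "\<exists>w. inj_on w F \<and> (\<forall>n\<in>F. v n < w n \<and> w n \<le> v n + \<epsilon>)"
  using assms(1)
proof induction
  case empty
  show ?case by simp
next
  case (insert m F)
  then obtain w where w: "inj_on w F" "\<forall>n\<in>F. v n < w n \<and> w n \<le> v n + \<epsilon>"
    by blast
  have "infinite {v m <.. v m + \<epsilon>}" using assms(2) by simp
  then have "\<not> {v m <.. v m + \<epsilon>} \<subseteq> w ` F"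
    using insert.hyps(1) finite_subset by blast
  then obtain s where s: "s \<in> {v m <.. v m + \<epsilon>}" "s \<notin> w ` F" by blast
  show ?case
    using insert.hyps(2) w s
    by (intro exI[of _ "w(m := s)"]) (auto simp: inj_on_def image_iff)
qed

section \<open>The p-th power of the norm\<close>

context p_banach_space
begin

text \<open>For \<open>p < 1\<close> the map \<open>nrm\<close> is in general only a quasi-norm,
  while its p-th power obeys the triangle inequality with constant 1. All estimates are therefore
  made for \<open>pn\<close>.\<close>

definition pn :: "'x \<Rightarrow> real" where
  "pn x = nrm x powr p"

lemma pn_nonneg [simp]: "0 \<le> pn x"
  by (simp add: pn_def)

lemma pn_0 [simp]: "pn 0 = 0"
  using nrm_eq_0_iff[of 0] by (simp add: pn_def)

lemma pn_add: "pn (x + y) \<le> pn x + pn y"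
  by (simp add: pn_def nrm_powr_add_le)

lemma pn_scale: "pn (smul a x) = norm a powr p * pn x"
  by (simp add: pn_def nrm_scale powr_mult nrm_nonneg)

lemma pn_minus [simp]: "pn (- x) = pn x"
  using pn_scale[of "- 1" x] by (simp add: scale_minus_left)

lemma pn_diff: "pn (x - y) \<le> pn x + pn y"
  using pn_add[of x "- y"] by simp

lemma pn_minus_commute: "pn (x - y) = pn (y - x)"
  using pn_minus[of "x - y"] by (simp del: pn_minus)

lemma pn_sum: "pn (sum f A) \<le> (\<Sum>n\<in>A. pn (f n))"
proof (induction A rule: infinite_finite_induct)
  case (insert x F)
  then show ?case using pn_add[of "f x" "sum f F"] by simp
qed simp_all

lemma nrm_le_of_pn_le:
  assumes "pn x \<le> C * pn y" "0 \<le> C"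
  shows "nrm x \<le> C powr (1 / p) * nrm y"
proof -
  have "pn x powr (1 / p) \<le> (C * pn y) powr (1 / p)"
    using assms p_pos by (intro powr_mono2) auto
  then show ?thesis
    using p_pos assms(2) by (simp add: pn_def powr_mult powr_powr nrm_nonneg)
qed

lemma pn_le_of_nrm_le:
  assumes "nrm x \<le> C * nrm y" "0 \<le> C"
  shows "pn x \<le> C powr p * pn y"
proof -
  have "nrm x powr p \<le> (C * nrm y) powr p"
    using assms p_pos by (intro powr_mono2) (auto simp: nrm_nonneg)
  then show ?thesis
    using assms(2) by (simp add: pn_def powr_mult nrm_nonneg)
qed

text \<open>
  Halving the coefficients, \<open>2 r = d + r'\<close> with \<open>d \<in> {0, 1}\<close> and \<open>r' \<in> [0, 1]\<close>, shows that the
  supremum \<open>S\<close> of the left-hand sides satisfies \<open>2\<^sup>p S \<le> M + S\<close>.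
\<close>

lemma pn_sum_unit_interval_coeffs:
  assumes "finite A" and M: "\<And>A'. A' \<subseteq> A \<Longrightarrow> pn (sum y A') \<le> M"
    and r: "\<And>n. n \<in> A \<Longrightarrow> 0 \<le> r n \<and> r n \<le> 1"
  shows "pn (\<Sum>n\<in>A. smul (of_real (r n)) (y n)) \<le> M / (2 powr p - 1)"
proof -
  define R where "R = {r :: 'a \<Rightarrow> real. \<forall>n\<in>A. 0 \<le> r n \<and> r n \<le> 1}"
  define h where "h r = pn (\<Sum>n\<in>A. smul (of_real (r n)) (y n))" for r
  \<comment> \<open>The supremum must be known to be finite before it can be absorbed from the
    right-hand side.\<close>
  have bdd: "bdd_above (h ` R)"
  proof (rule bdd_aboveI2)
    fix s assume "s \<in> R"
    have "pn (smul (of_real (s n)) (y n)) \<le> pn (y n)" if "n \<in> A" for n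
    proof -
      have "0 \<le> s n" "s n \<le> 1" using \<open>s \<in> R\<close> that by (auto simp: R_def)
      then have "\<bar>s n\<bar> powr p \<le> 1" using p_pos by (simp add: powr_le1)
      then show ?thesis by (simp add: pn_scale mult_left_le_one_le)
    qed
    then show "h s \<le> (\<Sum>n\<in>A. pn (y n))"
      unfolding h_def by (intro order.trans[OF pn_sum] sum_mono)
  qed
  define S where "S = (SUP s\<in>R. h s)"
  have half: "2 powr p * h s \<le> M + S" if "s \<in> R" for s
  proof -
    define D where "D = {n\<in>A. s n \<ge> 1/2}"
    define s' where "s' n = (if n \<in> D then 2 * s n - 1 else 2 * s n)" for n
    have "s' \<in> R" using that by (auto simp: R_def s'_def D_def)
    have "smul 2 (\<Sum>n\<in>A. smul (of_real (s n)) (y n)) =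
          (\<Sum>n\<in>A. (if n \<in> D then y n else 0) + smul (of_real (s' n)) (y n))"
      by (auto simp: scale_sum_right s'_def algebra_simps intro!: sum.cong)
    also have "\<dots> = sum y D + (\<Sum>n\<in>A. smul (of_real (s' n)) (y n))"
      using assms(1) by (simp add: sum.distrib D_def flip: sum.inter_filter)
    finally have "2 powr p * h s = pn (sum y D + (\<Sum>n\<in>A. smul (of_real (s' n)) (y n)))"
      by (metis h_def norm_numeral pn_scale)
    also have "\<dots> \<le> pn (sum y D) + h s'"
      unfolding h_def by (rule pn_add)
    also have "\<dots> \<le> M + S"
      unfolding S_def using \<open>s' \<in> R\<close> bdd
      by (intro add_mono M cSUP_upper) (auto simp: D_def)
    finally show ?thesis .
  qed
  have "r \<in> R" using r by (simp add: R_def)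
  have "S \<le> (M + S) / 2 powr p"
    unfolding S_def using \<open>r \<in> R\<close> half
    by (intro cSUP_least) (auto simp: S_def field_simps)
  then have "(2 powr p - 1) * S \<le> M" by (simp add: field_simps)
  moreover have "2 powr p > 1" using p_pos by simp
  ultimately have "S \<le> M / (2 powr p - 1)" by (simp add: field_simps)
  moreover have "h r \<le> S"
    unfolding S_def using \<open>r \<in> R\<close> bdd by (rule cSUP_upper)
  ultimately show ?thesis by (simp add: h_def)
qed

text \<open>The factor 4 counts the positive and negative parts of the two real coordinates of a
  scalar; each part costs \<open>1 / (2 powr p - 1)\<close>.\<close>

definition convexity_const :: real where
  "convexity_const = 4 / (2 powr p - 1)"

lemma convexity_const_pos: "convexity_const > 0"
  using p_pos by (simp add: convexity_const_def)

text \<open>After division by \<open>t\<close>, each coefficient splits into the positive and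
  negative parts of its two real coordinates. This gives four families with values in
  \<open>[0, 1]\<close>, to which the halving argument applies.\<close>

lemma pn_sum_bounded_coeffs:
  assumes "finite A" and M: "\<And>A'. A' \<subseteq> A \<Longrightarrow> pn (sum y A') \<le> M"
    and a: "\<And>n. n \<in> A \<Longrightarrow> norm (a n) \<le> t"
  shows "pn (\<Sum>n\<in>A. smul (a n) (y n)) \<le> convexity_const * t powr p * M"
proof (cases "t > 0")
  case False
  then have "a n = 0" if "n \<in> A" for n
    using a[OF that] norm_le_zero_iff[of "a n"] by linarith
  moreover have "0 \<le> M" using M[of "{}"] by simp
  ultimately show ?thesis using convexity_const_pos by simp
next
  case t: True
  obtain u :: 'k and S T where u: "norm u = 1"
    and ST: "\<And>z. z = of_real (S z) + of_real (T z) * u"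
      "\<And>z. \<bar>S z\<bar> \<le> norm z" "\<And>z. \<bar>T z\<bar> \<le> norm z"
    by (rule real_or_complex_parts) (rule that)
  define comb where "comb r = (\<Sum>n\<in>A. smul (of_real (r n)) (y n))" for r
  let ?M = "M / (2 powr p - 1)"
  have comb: "pn (comb (\<lambda>n. max 0 (f (a n) / t))) \<le> ?M \<and> pn (comb (\<lambda>n. max 0 (- f (a n) / t))) \<le> ?M"
    if "\<And>z. \<bar>f z\<bar> \<le> norm z" for f
  proof -
    have "\<bar>f (a n)\<bar> \<le> t" if "n \<in> A" for n
      using a[OF that] \<open>\<And>z. \<bar>f z\<bar> \<le> norm z\<close>[of "a n"] by linarith
    then have "f (a n) \<le> t \<and> - t \<le> f (a n)" if "n \<in> A" for n
      using that by (simp add: abs_le_iff minus_le_iff)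
    then show ?thesis
      unfolding comb_def using t
      by (intro conjI pn_sum_unit_interval_coeffs[OF assms(1) M]) (auto simp: field_simps)
  qed
  have pos_neg: "comb (\<lambda>n. f (a n) / t) = comb (\<lambda>n. max 0 (f (a n) / t)) - comb (\<lambda>n. max 0 (- f (a n) / t))"
    for f :: "'k \<Rightarrow> real"
    unfolding comb_def sum_subtractf[symmetric]
    by (rule sum.cong) (auto simp: max_def simp flip: scale_left_diff_distrib of_real_diff)
  have real_part: "pn (comb (\<lambda>n. f (a n) / t)) \<le> 2 * ?M" if "\<And>z. \<bar>f z\<bar> \<le> norm z" for f
    unfolding pos_neg using comb[of f, OF that]
    by (intro order.trans[OF pn_diff]) simp
  have "a n = of_real t * (of_real (S (a n) / t) + u * of_real (T (a n) / t))" for n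
    using t by (subst ST(1)[of "a n"]) (simp add: field_simps)
  then have "(\<Sum>n\<in>A. smul (a n) (y n)) =
      (\<Sum>n\<in>A. smul (of_real t * (of_real (S (a n) / t) + u * of_real (T (a n) / t))) (y n))"
    by simp
  also have "\<dots> = smul (of_real t) (comb (\<lambda>n. S (a n) / t) + smul u (comb (\<lambda>n. T (a n) / t)))"
    by (simp add: comb_def scale_sum_right sum.distrib scale_left_distrib scale_right_distrib
        distrib_left mult.assoc del: of_real_divide)
  finally have "pn (\<Sum>n\<in>A. smul (a n) (y n)) =
      t powr p * pn (comb (\<lambda>n. S (a n) / t) + smul u (comb (\<lambda>n. T (a n) / t)))"
    using t by (simp add: pn_scale)
  also have "\<dots> \<le> t powr p * (2 * ?M + 2 * ?M)"
    using real_part[of S, OF ST(2)] real_part[of T, OF ST(3)] u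
    by (intro mult_left_mono order.trans[OF pn_add]) (auto simp: pn_scale)
  also have "\<dots> = convexity_const * t powr p * M"
    by (simp add: convexity_const_def)
  finally show ?thesis .
qed

text \<open>The error made by replacing \<open>1\<close> with \<open>1 + r n\<close> is at most half
  of \<open>pn (sum y A)\<close> and is absorbed on the left. The control of partial sums by
  \<open>D\<close> will come from quasi-greediness.\<close>

lemma pn_sum_le_perturbed:
  assumes "finite A" and D: "\<And>A'. A' \<subseteq> A \<Longrightarrow> pn (sum y A') \<le> D * pn (sum y A)"
    and r: "\<And>n. n \<in> A \<Longrightarrow> norm (r n) \<le> \<delta>"
    and small: "convexity_const * D * \<delta> powr p \<le> 1 / 2"
  shows "pn (sum y A) \<le> 2 * pn (\<Sum>n\<in>A. smul (1 + r n) (y n))"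
proof -
  let ?e = "\<Sum>n\<in>A. smul (r n) (y n)"
  have "sum y A = (\<Sum>n\<in>A. smul (1 + r n) (y n)) - ?e"
    by (simp add: scale_left_distrib sum.distrib)
  then have "pn (sum y A) \<le> pn (\<Sum>n\<in>A. smul (1 + r n) (y n)) + pn ?e"
    using pn_diff by metis
  moreover have "pn ?e \<le> convexity_const * \<delta> powr p * (D * pn (sum y A))"
    by (rule pn_sum_bounded_coeffs[OF assms(1) D r])
  moreover have "\<dots> \<le> 1 / 2 * pn (sum y A)"
    using mult_right_mono[OF small, of "pn (sum y A)"] by (simp add: mult_ac)
  ultimately show ?thesis by linarith
qed

end

section \<open>Bounded biorthogonal systems\<close>

text \<open>One constant \<open>c\<close> bounds both the vectors and the functionals. Density of
  the span enters separately, as the assumption \<open>dense\<close> of the approximation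
  lemmas.\<close>

locale bounded_biorthogonal_system = p_banach_space smul p nrm
  for smul :: "'k::real_or_complex \<Rightarrow> 'x::ab_group_add \<Rightarrow> 'x" and p nrm +
  fixes b :: "nat \<Rightarrow> 'x" and b' :: "nat \<Rightarrow> 'x \<Rightarrow> 'k" and c :: real
  assumes c_pos: "0 < c"
    and coord_add: "b' n (x + y) = b' n x + b' n y"
    and coord_scale: "b' n (smul a x) = a * b' n x"
    and biorthogonal: "b' n (b m) = (if n = m then 1 else 0)"
    and coord_bound: "norm (b' n x) \<le> c * nrm x"
    and basis_bound: "nrm (b n) \<le> c"
begin

abbreviation lincomb :: "(nat \<Rightarrow> 'k) \<Rightarrow> nat set \<Rightarrow> 'x" where
  "lincomb a F \<equiv> (\<Sum>n\<in>F. smul (a n) (b n))"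

abbreviation P :: "nat set \<Rightarrow> 'x \<Rightarrow> 'x" where
  "P \<equiv> proj smul b b'"

lemma coord_0 [simp]: "b' n 0 = 0"
  using coord_add[of n 0 0] by simp

lemma coord_minus [simp]: "b' n (- x) = - b' n x"
  using coord_add[of n x "- x"] by (simp add: eq_neg_iff_add_eq_0 add.commute)

lemma coord_diff: "b' n (x - y) = b' n x - b' n y"
  using coord_add[of n x "- y"] by simp

lemma coord_sum: "b' n (sum f F) = (\<Sum>m\<in>F. b' n (f m))"
  by (induction F rule: infinite_finite_induct) (simp_all add: coord_add)

lemma coord_lincomb: "finite F \<Longrightarrow> b' n (lincomb a F) = (if n \<in> F then a n else 0)"
  by (simp add: coord_sum coord_scale biorthogonal if_distrib sum.delta' cong: if_cong)

lemma coord_proj: "finite A \<Longrightarrow> b' n (P A x) = (if n \<in> A then b' n x else 0)"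
  by (simp add: proj_def coord_lincomb)

lemma proj_lincomb: "finite F \<Longrightarrow> A \<subseteq> F \<Longrightarrow> P A (lincomb a F) = lincomb a A"
  unfolding proj_def by (rule sum.cong) (auto simp: coord_lincomb)

lemma proj_diff: "P A (x - y) = P A x - P A y"
  by (simp add: proj_def coord_diff scale_left_diff_distrib sum_subtractf)

lemma proj_empty [simp]: "P {} x = 0"
  by (simp add: proj_def)

lemma pn_basis: "pn (b n) \<le> c powr p"
  unfolding pn_def using p_pos by (intro powr_mono2 basis_bound) (auto simp: nrm_nonneg)

lemma pn_lincomb_le:
  assumes "\<And>n. n \<in> F \<Longrightarrow> norm (a n) \<le> t"
  shows "pn (lincomb a F) \<le> real (card F) * c powr p * t powr p"
proof -
  have "pn (smul (a n) (b n)) \<le> t powr p * c powr p" if "n \<in> F" for n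
    unfolding pn_scale using p_pos assms[OF that]
    by (intro mult_mono powr_mono2 pn_basis) auto
  then have "(\<Sum>n\<in>F. pn (smul (a n) (b n))) \<le> real (card F) * (t powr p * c powr p)"
    by (rule sum_bounded_above)
  then show ?thesis
    using pn_sum[of "\<lambda>n. smul (a n) (b n)" F] by (simp add: mult_ac)
qed

text \<open>Continuity of a finite projection. The constant grows with \<open>card A\<close>, which
  is harmless where \<open>A\<close> stays fixed while the vector varies.\<close>

lemma pn_proj_le: "pn (P A x) \<le> real (card A) * c powr p * c powr p * pn x"
  using pn_lincomb_le[of A "\<lambda>n. b' n x" "c * nrm x"] coord_bound c_pos
  by (simp add: proj_def pn_def powr_mult nrm_nonneg mult_ac)

text \<open>The freedom to enlarge \<open>F0\<close> matters later, where the finite set must also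
  contain a prescribed greedy set.\<close>

lemma span_eq_proj:
  assumes "y \<in> span (range b)"
  obtains F0 where "finite F0" "\<And>F. finite F \<Longrightarrow> F0 \<subseteq> F \<Longrightarrow> y = P F y"
proof -
  have "\<exists>F0. finite F0 \<and> (\<forall>F. finite F \<longrightarrow> F0 \<subseteq> F \<longrightarrow> y = P F y)"
    using assms
  proof (induction rule: span_induct_alt)
    case base
    show ?case by (auto simp: proj_def)
  next
    case (step a x y)
    then obtain F0 n where F0: "finite F0" "\<forall>F. finite F \<longrightarrow> F0 \<subseteq> F \<longrightarrow> y = P F y" "x = b n"
      by blast
    have "smul a x + y = P F (smul a x + y)" if "finite F" "insert n F0 \<subseteq> F" for F
    proof -
      have "P F (smul a x + y) = (\<Sum>m\<in>F. smul (if m = n then a else 0) (b m)) + P F y"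
        unfolding proj_def sum.distrib[symmetric]
        by (rule sum.cong) (auto simp: coord_add coord_scale F0(3) biorthogonal scale_left_distrib)
      moreover have "(\<Sum>m\<in>F. smul (if m = n then a else 0) (b m)) = smul a x"
        using that by (simp add: F0(3) if_distrib[of "\<lambda>a. smul a _"] cong: if_cong)
      ultimately show ?thesis using F0(2) that by simp
    qed
    then show ?case using F0(1) by (intro exI[of _ "insert n F0"]) auto
  qed
  then show ?thesis using that by blast
qed

section \<open>Greedy-type inequalities restated for \<open>pn\<close>, with the infimum replaced by
  a quantifier over competitors\<close>

lemma almost_greedy_on_iff:
  "almost_greedy_on S smul nrm b b' \<longleftrightarrow>
     (\<exists>C>0. \<forall>x\<in>S. \<forall>A B. greedy_set b' x A \<longrightarrow> finite B \<longrightarrow> card B \<le> card A \<longrightarrow>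
        pn (x - P A x) \<le> C * pn (x - P B x))"
proof
  assume "almost_greedy_on S smul nrm b b'"
  then obtain C where C: "C > 0" and le: "\<And>x A. x \<in> S \<Longrightarrow> greedy_set b' x A \<Longrightarrow>
      nrm (x - P A x) \<le> C * (INF B\<in>{B. finite B \<and> card B \<le> card A}. nrm (x - P B x))"
    unfolding almost_greedy_on_def by blast
  have "pn (x - P A x) \<le> C powr p * pn (x - P B x)"
    if "x \<in> S" "greedy_set b' x A" "finite B" "card B \<le> card A" for x A B
  proof -
    have "(INF B\<in>{B. finite B \<and> card B \<le> card A}. nrm (x - P B x)) \<le> nrm (x - P B x)"
      using that by (intro cINF_lower bdd_belowI2[of _ 0]) (auto simp: nrm_nonneg)
    then have "nrm (x - P A x) \<le> C * nrm (x - P B x)"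
      using le[OF that(1,2)] C by (meson mult_left_mono order.trans less_imp_le)
    then show ?thesis using C by (intro pn_le_of_nrm_le) auto
  qed
  then show "\<exists>C>0. \<forall>x\<in>S. \<forall>A B. greedy_set b' x A \<longrightarrow> finite B \<longrightarrow> card B \<le> card A \<longrightarrow>
        pn (x - P A x) \<le> C * pn (x - P B x)"
    using C by (intro exI[of _ "C powr p"]) auto
next
  assume "\<exists>C>0. \<forall>x\<in>S. \<forall>A B. greedy_set b' x A \<longrightarrow> finite B \<longrightarrow> card B \<le> card A \<longrightarrow>
        pn (x - P A x) \<le> C * pn (x - P B x)"
  then obtain C where C: "C > 0" and le: "\<And>x A B. x \<in> S \<Longrightarrow> greedy_set b' x A \<Longrightarrow> finite B \<Longrightarrow>
      card B \<le> card A \<Longrightarrow> pn (x - P A x) \<le> C * pn (x - P B x)"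
    by blast
  define D where "D = C powr (1 / p)"
  have D: "D > 0" using C by (simp add: D_def)
  have "nrm (x - P A x) \<le> D * (INF B\<in>{B. finite B \<and> card B \<le> card A}. nrm (x - P B x))"
    if "x \<in> S" "greedy_set b' x A" for x A
  proof -
    have bound: "nrm (x - P A x) \<le> D * nrm (x - P B x)" if "finite B" "card B \<le> card A" for B
      unfolding D_def
      using le[OF \<open>x \<in> S\<close> \<open>greedy_set b' x A\<close> that] C by (intro nrm_le_of_pn_le) auto
    have "nrm (x - P A x) / D \<le> (INF B\<in>{B. finite B \<and> card B \<le> card A}. nrm (x - P B x))"
    proof (rule cINF_greatest)
      \<comment> \<open>The empty competitor makes the infimum one over a nonempty set.\<close>
      have "{} \<in> {B :: nat set. finite B \<and> card B \<le> card A}" by simp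
      then show "{B :: nat set. finite B \<and> card B \<le> card A} \<noteq> {}" by (metis empty_iff)
    next
      fix B :: "nat set" assume "B \<in> {B. finite B \<and> card B \<le> card A}"
      then show "nrm (x - P A x) / D \<le> nrm (x - P B x)"
        using bound[of B] D by (simp add: pos_divide_le_eq mult.commute)
    qed
    then show ?thesis using D by (simp add: pos_divide_le_eq mult.commute)
  qed
  then show "almost_greedy_on S smul nrm b b'"
    unfolding almost_greedy_on_def using D by (intro exI[of _ D]) simp
qed

lemma quasi_greedy_iff:
  "quasi_greedy smul nrm b b' \<longleftrightarrow>
     (\<exists>C>0. \<forall>x A. greedy_set b' x A \<longrightarrow> pn (x - P A x) \<le> C * pn x)"
proof
  assume "quasi_greedy smul nrm b b'"
  then obtain C where "C > 0" "\<And>x A. greedy_set b' x A \<Longrightarrow> nrm (x - P A x) \<le> C * nrm x"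
    unfolding quasi_greedy_def by blast
  then show "\<exists>C>0. \<forall>x A. greedy_set b' x A \<longrightarrow> pn (x - P A x) \<le> C * pn x"
    by (intro exI[of _ "C powr p"]) (auto intro!: pn_le_of_nrm_le)
next
  assume "\<exists>C>0. \<forall>x A. greedy_set b' x A \<longrightarrow> pn (x - P A x) \<le> C * pn x"
  then obtain C where "C > 0" "\<And>x A. greedy_set b' x A \<Longrightarrow> pn (x - P A x) \<le> C * pn x"
    by blast
  then show "quasi_greedy smul nrm b b'"
    unfolding quasi_greedy_def
    by (intro exI[of _ "C powr (1 / p)"]) (auto intro!: nrm_le_of_pn_le)
qed

lemma democratic_iff:
  "democratic nrm b \<longleftrightarrow>
     (\<exists>C>0. \<forall>A B. finite A \<longrightarrow> finite B \<longrightarrow> card A \<le> card B \<longrightarrow>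
        pn (sum b A) \<le> C * pn (sum b B))"
proof
  assume "democratic nrm b"
  then obtain C where "C > 0" "\<And>A B. finite A \<Longrightarrow> finite B \<Longrightarrow> card A \<le> card B \<Longrightarrow>
      nrm (sum b A) \<le> C * nrm (sum b B)"
    unfolding democratic_def indicator_sum_def by blast
  then show "\<exists>C>0. \<forall>A B. finite A \<longrightarrow> finite B \<longrightarrow> card A \<le> card B \<longrightarrow>
        pn (sum b A) \<le> C * pn (sum b B)"
    by (intro exI[of _ "C powr p"]) (auto intro!: pn_le_of_nrm_le)
next
  assume "\<exists>C>0. \<forall>A B. finite A \<longrightarrow> finite B \<longrightarrow> card A \<le> card B \<longrightarrow>
        pn (sum b A) \<le> C * pn (sum b B)"
  then obtain C where "C > 0" "\<And>A B. finite A \<Longrightarrow> finite B \<Longrightarrow> card A \<le> card B \<Longrightarrow>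
      pn (sum b A) \<le> C * pn (sum b B)"
    by blast
  then show "democratic nrm b"
    unfolding democratic_def indicator_sum_def
    by (intro exI[of _ "C powr (1 / p)"]) (auto intro!: nrm_le_of_pn_le)
qed

section \<open>Almost-greedy bases are quasi-greedy and democratic\<close>

lemma quasi_greedy_of_almost_greedy:
  assumes "almost_greedy smul nrm b b'"
  shows "quasi_greedy smul nrm b b'"
proof -
  obtain C where C: "C > 0" and le: "\<And>x A B. greedy_set b' x A \<Longrightarrow> finite B \<Longrightarrow>
      card B \<le> card A \<Longrightarrow> pn (x - P A x) \<le> C * pn (x - P B x)"
    using assms unfolding almost_greedy_on_iff by blast
  show ?thesis
    unfolding quasi_greedy_iff using C le[of _ _ "{}"] by (intro exI[of _ C]) auto
qed

lemma democratic_of_almost_greedy: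
  assumes "almost_greedy smul nrm b b'"
  shows "democratic nrm b"
proof -
  obtain C where C: "C > 0" and le: "\<And>x A B. greedy_set b' x A \<Longrightarrow> finite B \<Longrightarrow>
      card B \<le> card A \<Longrightarrow> pn (x - P A x) \<le> C * pn (x - P B x)"
    using assms unfolding almost_greedy_on_iff by blast
  have disjoint: "pn (sum b A) \<le> C * pn (sum b B)"
    if AB: "finite A" "finite B" "card A \<le> card B" "A \<inter> B = {}" for A B
  proof -
    \<comment> \<open>All nonzero coefficients are equal, so \<open>B\<close> is greedy while
      \<open>A\<close> is an admissible competitor; removing either set leaves the indicator sum of
      the other.\<close>
    let ?x = "lincomb (\<lambda>_. 1) (A \<union> B)"
    have "greedy_set b' ?x B"
      using AB by (auto simp: greedy_set_def coord_lincomb simp del: scale_one)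
    from le[OF this AB(1,3)]
    have "pn (?x - P B ?x) \<le> C * pn (?x - P A ?x)" .
    moreover have "?x = sum b A + sum b B"
      using AB by (simp add: sum.union_disjoint)
    moreover have "P B ?x = sum b B" "P A ?x = sum b A"
      using AB by (subst proj_lincomb; simp)+
    ultimately show ?thesis by simp
  qed
  have "pn (sum b A) \<le> C * C * pn (sum b B)"
    if AB: "finite A" "finite B" "card A \<le> card B" for A B
  proof -
    \<comment> \<open>Overlapping sets are compared through a third set \<open>D\<close> of size
      \<open>card B\<close> disjoint from both, whence the squared constant.\<close>
    have "infinite (- (A \<union> B))"
      using Diff_infinite_finite[of "A \<union> B" UNIV] AB by (simp add: Compl_eq_Diff_UNIV)
    then obtain D where D: "finite D" "card D = card B" "D \<subseteq> - (A \<union> B)"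
      by (meson infinite_arbitrarily_large)
    have "pn (sum b A) \<le> C * pn (sum b D)"
      using AB D by (intro disjoint) auto
    also have "C * pn (sum b D) \<le> C * (C * pn (sum b B))"
      using AB D C by (intro mult_left_mono disjoint) auto
    finally show ?thesis by (simp add: mult.assoc)
  qed
  then show ?thesis
    unfolding democratic_iff using C by (intro exI[of _ "C * C"]) auto
qed

end

section \<open>Quasi-greedy systems: phases, modulus levels, and the use of democracy\<close>

locale quasi_greedy_system = bounded_biorthogonal_system smul p nrm b b' c
  for smul :: "'k::real_or_complex \<Rightarrow> 'x::ab_group_add \<Rightarrow> 'x" and p nrm b b' c +
  fixes Q :: real
  assumes Q_nonneg: "0 \<le> Q"
    and quasi_greedy_bound: "greedy_set b' x A \<Longrightarrow> pn (x - P A x) \<le> Q * pn x"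
begin

lemma pn_greedy_proj: "greedy_set b' x A \<Longrightarrow> pn (P A x) \<le> (1 + Q) * pn x"
  using pn_diff[of x "x - P A x"] quasi_greedy_bound[of x A] by (simp add: distrib_right)

text \<open>When all coefficients on \<open>G\<close> have modulus 1, every subset of
  \<open>G\<close> is a greedy set. This supplies the partial-sum hypothesis of
  \<open>pn_sum_le_perturbed\<close> with \<open>D = 1 + Q\<close>.\<close>

lemma pn_unimodular_subset:
  assumes "finite G" "A \<subseteq> G" "\<And>n. n \<in> G \<Longrightarrow> norm (e n) = 1"
  shows "pn (lincomb e A) \<le> (1 + Q) * pn (lincomb e G)"
proof -
  have "greedy_set b' (lincomb e G) A"
    using assms finite_subset[OF assms(2,1)] by (auto simp: greedy_set_def coord_lincomb)
  from pn_greedy_proj[OF this] show ?thesis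
    using assms by (simp add: proj_lincomb)
qed

lemma exists_small_perturbation:
  obtains \<delta> where "\<delta> > 0" "convexity_const * (1 + Q) * \<delta> powr p \<le> 1 / 2"
proof -
  have "0 \<le> convexity_const * (1 + Q)"
    using convexity_const_pos Q_nonneg by simp
  then obtain \<delta> where \<delta>: "\<delta> > 0" "convexity_const * (1 + Q) * \<delta> powr p < 1 / 2"
    using exists_powr_less[OF p_pos, of "convexity_const * (1 + Q)" "1 / 2"] by auto
  show ?thesis
    by (rule that[of \<delta>]) (use \<delta> in simp_all)
qed

text \<open>On the indices whose phases lie in one small cell the phase is almost constant.\<close>

lemma pn_indicator_le_unimodular:
  "\<exists>C>0. \<forall>G e. finite G \<longrightarrow> (\<forall>n\<in>G. norm (e n) = 1) \<longrightarrow> pn (sum b G) \<le> C * pn (lincomb e G)"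
proof -
  obtain \<delta> where \<delta>: "\<delta> > 0" "convexity_const * (1 + Q) * \<delta> powr p \<le> 1 / 2"
    by (rule exists_small_perturbation)
  obtain cell :: "'k \<Rightarrow> int \<times> int" and Z where Z: "finite Z"
    "\<And>z. norm z = 1 \<Longrightarrow> cell z \<in> Z"
    "\<And>z w. cell z = cell w \<Longrightarrow> norm (z - w) \<le> \<delta>"
    by (rule finite_cells_unit_sphere[OF \<delta>(1)]) (rule that)
  define K where "K = 2 * (1 + Q)"
  have K: "K > 0" using Q_nonneg by (simp add: K_def)
  have main: "pn (sum b G) \<le> real (card Z) * K * pn (lincomb e G)"
    if G: "finite G" and e: "\<And>n. n \<in> G \<Longrightarrow> norm (e n) = 1" for G e
  proof -
    have cell_bound: "pn (sum b {n \<in> G. cell (e n) = z}) \<le> K * pn (lincomb e G)" for z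
    proof (cases "{n \<in> G. cell (e n) = z} = {}")
      case True
      then show ?thesis using K by (simp only:) simp
    next
      case False
      let ?A = "{n \<in> G. cell (e n) = z}"
      obtain m where m: "m \<in> G" "cell (e m) = z" using False by blast
      have "e m \<noteq> 0" using e[OF m(1)] by auto
      \<comment> \<open>Dividing by the phase of one representative \<open>m\<close> makes every
        phase in the cell within \<open>\<delta>\<close> of 1.\<close>
      have "pn (sum b ?A) \<le> 2 * pn (\<Sum>n\<in>?A. smul (1 + (e n / e m - 1)) (b n))"
      proof (rule pn_sum_le_perturbed[OF _ _ _ \<delta>(2)])
        fix A' assume "A' \<subseteq> ?A"
        then show "pn (sum b A') \<le> (1 + Q) * pn (sum b ?A)"
          using pn_unimodular_subset[of ?A A' "\<lambda>_. 1"] G by simp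
      next
        fix n assume n: "n \<in> ?A"
        have "e n / e m - 1 = (e n - e m) / e m"
          using \<open>e m \<noteq> 0\<close> by (simp add: field_simps)
        then have "norm (e n / e m - 1) = norm (e n - e m)"
          using e[OF m(1)] by (simp add: norm_divide)
        then show "norm (e n / e m - 1) \<le> \<delta>" using n m Z(3) by simp
      qed (use G in simp)
      also have "(\<Sum>n\<in>?A. smul (1 + (e n / e m - 1)) (b n)) = smul (inverse (e m)) (lincomb e ?A)"
        unfolding scale_sum_right by (rule sum.cong) (simp_all add: divide_inverse mult.commute)
      also have "pn \<dots> = pn (lincomb e ?A)"
        using e[OF m(1)] by (simp add: pn_scale norm_inverse)
      also have "2 * \<dots> \<le> 2 * ((1 + Q) * pn (lincomb e G))"
        using G e by (intro mult_left_mono pn_unimodular_subset) auto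
      finally show ?thesis by (simp only: K_def mult.assoc)
    qed
    have "sum b G = (\<Sum>z\<in>Z. sum b {n \<in> G. cell (e n) = z})"
      using G e Z by (intro sum.group[symmetric]) auto
    also have "pn \<dots> \<le> (\<Sum>z\<in>Z. pn (sum b {n \<in> G. cell (e n) = z}))"
      by (rule pn_sum)
    also have "\<dots> \<le> real (card Z) * (K * pn (lincomb e G))"
      using cell_bound by (intro sum_bounded_above)
    finally show ?thesis by (simp add: mult.assoc)
  qed
  \<comment> \<open>The added 1 keeps the constant positive even if \<open>Z\<close> is
    empty.\<close>
  have "pn (sum b G) \<le> (real (card Z) * K + 1) * pn (lincomb e G)"
    if "finite G" "\<forall>n\<in>G. norm (e n) = 1" for G e
    using main[of G e] that by (simp add: distrib_right add_increasing2)
  then show ?thesis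
    using K by (intro exI[of _ "real (card Z) * K + 1"]) (auto intro: add_nonneg_pos)
qed

text \<open>On one level, \<open>a n\<close> is \<open>s\<close> times its sign times a factor in
  \<open>[1, 1 + \<delta>]\<close>. The perturbation lemma is applied to the vectors
  \<open>smul (sgn (a n)) (b n)\<close>.\<close>

lemma pn_signs_le_level:
  assumes \<delta>: "\<delta> > 0" "convexity_const * (1 + Q) * \<delta> powr p \<le> 1 / 2"
    and G: "finite G" and s: "s > 0"
    and a: "\<And>n. n \<in> G \<Longrightarrow> s \<le> norm (a n) \<and> norm (a n) \<le> (1 + \<delta>) * s"
  shows "s powr p * pn (lincomb (\<lambda>n. sgn (a n)) G) \<le> 2 * pn (lincomb a G)"
proof -
  define r where "r n = (of_real (norm (a n) / s - 1) :: 'k)" for n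
  have sgn1: "norm (sgn (a n)) = 1" if "n \<in> G" for n
    using a[OF that] s by (auto simp: norm_sgn)
  have a_eq: "a n = of_real s * ((1 + r n) * sgn (a n))" if "n \<in> G" for n
    using a[OF that] s by (auto simp: r_def sgn_div_norm scaleR_conv_of_real field_simps)
  have le: "pn (lincomb (\<lambda>n. sgn (a n)) G) \<le> 2 * pn (\<Sum>n\<in>G. smul (1 + r n) (smul (sgn (a n)) (b n)))"
  proof (rule pn_sum_le_perturbed[OF G _ _ \<delta>(2)])
    fix A' assume "A' \<subseteq> G"
    then show "pn (lincomb (\<lambda>n. sgn (a n)) A') \<le> (1 + Q) * pn (lincomb (\<lambda>n. sgn (a n)) G)"
      using G sgn1 by (intro pn_unimodular_subset) auto
  next
    fix n assume "n \<in> G"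
    have "0 \<le> norm (a n) / s - 1" "norm (a n) / s - 1 \<le> \<delta>"
      using a[OF \<open>n \<in> G\<close>] s by (auto simp: field_simps)
    then show "norm (r n) \<le> \<delta>" unfolding r_def norm_of_real by linarith
  qed
  have "lincomb a G = smul (of_real s) (\<Sum>n\<in>G. smul (1 + r n) (smul (sgn (a n)) (b n)))"
    unfolding scale_sum_right by (rule sum.cong) (use a_eq in auto)
  then have "pn (lincomb a G) = s powr p * pn (\<Sum>n\<in>G. smul (1 + r n) (smul (sgn (a n)) (b n)))"
    using s by (simp add: pn_scale)
  then show ?thesis
    using mult_left_mono[OF le, of "s powr p"] by (simp add: mult.left_commute)
qed

text \<open>
  The usual summation by parts over the decreasing rearrangement needs local convexity; grouping
  the coefficients into levels of ratio \<open>1 + \<delta>\<close> gives a geometric series instead.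
\<close>

lemma pn_signs_le_large_coeffs:
  "\<exists>C>0. \<forall>G a t. finite G \<longrightarrow> t > 0 \<longrightarrow> (\<forall>n\<in>G. t \<le> norm (a n)) \<longrightarrow>
     t powr p * pn (lincomb (\<lambda>n. sgn (a n)) G) \<le> C * pn (lincomb a G)"
proof -
  obtain \<delta> where \<delta>: "\<delta> > 0" "convexity_const * (1 + Q) * \<delta> powr p \<le> 1 / 2"
    by (rule exists_small_perturbation)
  define \<rho> where "\<rho> = 1 + \<delta>"
  have \<rho>: "\<rho> > 1" using \<delta>(1) by (simp add: \<rho>_def)
  define q where "q = inverse (\<rho> powr p)"
  have "\<rho> powr p > 1" using \<rho> p_pos by (rule gr_one_powr)
  then have q: "0 < q" "q < 1" using \<rho> by (simp_all add: q_def inverse_less_1_iff)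
  \<comment> \<open>One factor 2 comes from passing to signs on a level, the other from writing a
    level as a difference of two greedy sets.\<close>
  define K where "K = 4 * (1 + Q)"
  have K: "K > 0" using Q_nonneg by (simp add: K_def)
  have "t powr p * pn (lincomb (\<lambda>n. sgn (a n)) G) \<le> (K / (1 - q)) * pn (lincomb a G)"
    if G: "finite G" and t: "t > 0" and a: "\<And>n. n \<in> G \<Longrightarrow> t \<le> norm (a n)" for G a t
  proof -
    define f where "f = lincomb a G"
    \<comment> \<open>Since \<open>norm (a n) \<ge> t\<close> the logarithm is nonnegative, so
      \<open>nat\<close> cuts off nothing.\<close>
    define lev where "lev n = nat \<lfloor>log \<rho> (norm (a n) / t)\<rfloor>" for n
    have lev: "t * \<rho> ^ lev n \<le> norm (a n)" "norm (a n) \<le> t * \<rho> ^ Suc (lev n)" if "n \<in> G" for n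
    proof -
      have pos: "norm (a n) / t \<ge> 1" using a[OF that] t by simp
      then have "log \<rho> (norm (a n) / t) \<ge> 0" using \<rho> by simp
      then have "real (lev n) \<le> log \<rho> (norm (a n) / t)" "log \<rho> (norm (a n) / t) \<le> real (Suc (lev n))"
        unfolding lev_def by linarith+
      then have "\<rho> ^ lev n \<le> norm (a n) / t" "norm (a n) / t \<le> \<rho> ^ Suc (lev n)"
        using \<rho> pos by (simp_all add: le_log_iff log_le_iff powr_realpow del: power_Suc of_nat_Suc)
      then show "t * \<rho> ^ lev n \<le> norm (a n)" "norm (a n) \<le> t * \<rho> ^ Suc (lev n)"
        using t by (simp_all add: field_simps)
    qed
    have lev_mono: "lev n \<le> lev m" if "n \<in> G" "norm (a n) \<le> norm (a m)" for n m
    proof -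
      have "0 < norm (a n)" using a[OF that(1)] t by linarith
      then show ?thesis
        unfolding lev_def using that(2) t \<rho>
        by (intro nat_mono floor_mono log_mono) (auto simp: divide_right_mono)
    qed
    \<comment> \<open>As \<open>lev\<close> is monotone in the modulus, these upper level sets are
      greedy sets of \<open>f\<close>; a single level need not be.\<close>
    define H where "H j = {n \<in> G. j \<le> lev n}" for j
    have H_bound: "pn (lincomb a (H j)) \<le> (1 + Q) * pn f" for j
    proof -
      have "greedy_set b' f (H j)"
        unfolding greedy_set_def f_def
      proof (intro conjI ballI allI impI)
        fix n m assume nm: "n \<in> H j" "m \<notin> H j"
        have "norm (a m) \<le> norm (a n)" if "m \<in> G"
          using nm that lev_mono[of n m] by (force simp: H_def)
        then show "norm (b' m (lincomb a G)) \<le> norm (b' n (lincomb a G))"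
          using nm G by (simp add: coord_lincomb H_def)
      qed (use G in \<open>simp add: H_def\<close>)
      from pn_greedy_proj[OF this] show ?thesis
        unfolding f_def using G by (subst (asm) proj_lincomb) (auto simp: H_def)
    qed
    define L where "L j = {n \<in> G. lev n = j}" for j
    have L_bound: "t powr p * pn (lincomb (\<lambda>n. sgn (a n)) (L j)) \<le> q ^ j * (K * pn f)" for j
    proof -
      define s where "s = t * \<rho> ^ j"
      have s: "s > 0" using t \<rho> by (simp add: s_def)
      have "(\<rho> ^ j) powr p = (\<rho> powr p) ^ j"
        using \<rho> by (induction j) (simp_all add: powr_mult)
      \<comment> \<open>Lowering the threshold from \<open>s\<close> to \<open>t\<close> gains the
        factor \<open>q ^ j\<close>, which makes the sum over levels converge.\<close>
      then have s_powr: "t powr p = q ^ j * s powr p"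
        using t \<rho> by (simp add: s_def powr_mult q_def flip: power_mult_distrib)
      have "L j = H j - H (Suc j)" "H (Suc j) \<subseteq> H j" by (auto simp: L_def H_def)
      then have L_eq: "lincomb a (L j) = lincomb a (H j) - lincomb a (H (Suc j))"
        using G by (simp add: sum_diff H_def)
      have "pn (lincomb a (L j)) \<le> 2 * ((1 + Q) * pn f)"
        unfolding L_eq
        using pn_diff[of "lincomb a (H j)" "lincomb a (H (Suc j))"]
          H_bound[of j] H_bound[of "Suc j"] by linarith
      moreover have "s powr p * pn (lincomb (\<lambda>n. sgn (a n)) (L j)) \<le> 2 * pn (lincomb a (L j))"
      proof (rule pn_signs_le_level[OF \<delta> _ s])
        fix n assume "n \<in> L j"
        then show "s \<le> norm (a n) \<and> norm (a n) \<le> (1 + \<delta>) * s"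
          using lev[of n] by (auto simp: L_def s_def \<rho>_def mult_ac)
      qed (use G in \<open>simp add: L_def\<close>)
      ultimately have "s powr p * pn (lincomb (\<lambda>n. sgn (a n)) (L j)) \<le> K * pn f"
        unfolding K_def by linarith
      then show ?thesis
        unfolding s_powr using q by (simp add: mult.assoc)
    qed
    let ?J = "lev ` G"
    have "lincomb (\<lambda>n. sgn (a n)) G = (\<Sum>j\<in>?J. lincomb (\<lambda>n. sgn (a n)) (L j))"
      unfolding L_def using G by (intro sum.group[symmetric]) auto
    then have "t powr p * pn (lincomb (\<lambda>n. sgn (a n)) G)
        \<le> (\<Sum>j\<in>?J. t powr p * pn (lincomb (\<lambda>n. sgn (a n)) (L j)))"
      using pn_sum[of "\<lambda>j. lincomb (\<lambda>n. sgn (a n)) (L j)" ?J]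
      by (simp add: mult_left_mono flip: sum_distrib_left)
    also have "\<dots> \<le> (\<Sum>j\<in>?J. q ^ j * (K * pn f))"
      by (intro sum_mono L_bound)
    also have "\<dots> = (\<Sum>j\<in>?J. q ^ j) * (K * pn f)"
      by (simp add: sum_distrib_right)
    also have "\<dots> \<le> (1 / (1 - q)) * (K * pn f)"
    proof (rule mult_right_mono)
      have "(\<Sum>j\<in>?J. q ^ j) \<le> (\<Sum>j. q ^ j)"
        using G q by (intro sum_le_suminf summable_geometric) auto
      then show "(\<Sum>j\<in>?J. q ^ j) \<le> 1 / (1 - q)"
        using q by (simp add: suminf_geometric)
    qed (use K in simp)
    finally show ?thesis by (simp add: f_def)
  qed
  with K q show ?thesis by (intro exI[of _ "K / (1 - q)"]) auto
qed

text \<open>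
  With \<open>y = x - P\<^sub>B x\<close>, the vector \<open>x - P\<^sub>A x\<close> is the sum of \<open>y - P\<^bsub>A - B\<^esub> y\<close> and \<open>P\<^bsub>B - A\<^esub> x\<close>; the
  coefficients of the latter are at most the minimum of those of \<open>y\<close> on its greedy set \<open>A - B\<close>.
\<close>

lemma almost_greedy_of_democratic:
  assumes "democratic nrm b"
  shows "almost_greedy smul nrm b b'"
proof -
  obtain D where D: "D > 0" and dem: "\<And>A B. finite A \<Longrightarrow> finite B \<Longrightarrow> card A \<le> card B \<Longrightarrow>
      pn (sum b A) \<le> D * pn (sum b B)"
    using assms unfolding democratic_iff by blast
  obtain C1 where C1: "C1 > 0"
    "\<forall>G e. finite G \<longrightarrow> (\<forall>n\<in>G. norm (e n) = 1) \<longrightarrow> pn (sum b G) \<le> C1 * pn (lincomb e G)"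
    using pn_indicator_le_unimodular by blast
  obtain C2 where C2: "C2 > 0"
    "\<forall>G a t. finite G \<longrightarrow> t > 0 \<longrightarrow> (\<forall>n\<in>G. t \<le> norm (a n)) \<longrightarrow>
       t powr p * pn (lincomb (\<lambda>n. sgn (a n)) G) \<le> C2 * pn (lincomb a G)"
    using pn_signs_le_large_coeffs by blast
  define E where "E = convexity_const * D * C1 * C2 * (1 + Q)"
  have E: "E > 0" using D C1(1) C2(1) convexity_const_pos Q_nonneg by (simp add: E_def)
  have "pn (x - P A x) \<le> (Q + E) * pn (x - P B x)"
    if A: "greedy_set b' x A" and B: "finite B" "card B \<le> card A" for x A B
  proof -
    define y where "y = x - P B x"
    have finA: "finite A" using A by (simp add: greedy_set_def)
    have coord_y: "b' n y = (if n \<in> B then 0 else b' n x)" for n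
      using B by (simp add: y_def coord_diff coord_proj)
    \<comment> \<open>An index outside \<open>A - B\<close> lies in \<open>B\<close>, where
      \<open>y\<close> has coefficient 0, or outside \<open>A\<close>, where greediness of
      \<open>A\<close> applies.\<close>
    have greedy_y: "greedy_set b' y (A - B)"
      using A by (auto simp: greedy_set_def coord_y)
    have proj_y: "P (A - B) y = lincomb (\<lambda>n. b' n x) (A - B)"
      unfolding proj_def by (rule sum.cong) (auto simp: coord_y)
    have "P A x = lincomb (\<lambda>n. b' n x) (A \<inter> B) + P (A - B) y"
      using sum.Int_Diff[OF finA, of "\<lambda>n. smul (b' n x) (b n)" B]
      unfolding proj_y by (simp add: proj_def)
    moreover have "P B x = lincomb (\<lambda>n. b' n x) (A \<inter> B) + P (B - A) x"
      using sum.Int_Diff[OF B(1), of "\<lambda>n. smul (b' n x) (b n)" A]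
      by (simp add: proj_def Int_commute)
    ultimately have "x - P A x = (y - P (A - B) y) + P (B - A) x"
      by (simp add: y_def)
    then have split: "pn (x - P A x) \<le> pn (y - P (A - B) y) + pn (P (B - A) x)"
      using pn_add by metis
    have card: "card (B - A) \<le> card (A - B)"
      using B finA by (simp add: card_Diff_subset_Int Int_commute diff_le_mono)
    have "pn (P (B - A) x) \<le> E * pn y"
    \<comment> \<open>A nonzero coefficient makes the maximum \<open>t\<close> well defined and
      positive, as the lower estimate for large coefficients requires.\<close>
    proof (cases "\<exists>n \<in> B - A. b' n x \<noteq> 0")
      case False
      then have "P (B - A) x = 0" by (auto simp: proj_def intro: sum.neutral)
      then show ?thesis using E by simp
    next
      case True
      then obtain m where m: "m \<in> B - A" "b' m x \<noteq> 0" by blast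
      define t where "t = Max ((\<lambda>n. norm (b' n x)) ` (B - A))"
      have t_ge: "norm (b' n x) \<le> t" if "n \<in> B - A" for n
        unfolding t_def using B(1) that by (intro Max_ge) auto
      have t: "t > 0"
        using t_ge[OF m(1)] m(2) by (meson less_le_trans zero_less_norm_iff)
      \<comment> \<open>The maximum is attained at an index outside \<open>A\<close>, so it is a
        lower bound for the coefficients on \<open>A\<close>.\<close>
      have "t \<in> (\<lambda>n. norm (b' n x)) ` (B - A)"
        unfolding t_def using B(1) m(1) by (intro Max_in) auto
      then have t_le: "t \<le> norm (b' n x)" if "n \<in> A - B" for n
        using A that by (auto simp: greedy_set_def)
      \<comment> \<open>Democracy bounds all subsets of \<open>B - A\<close> at once by the
        indicator sum of \<open>A - B\<close>, since no such subset has more elements than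
        \<open>A - B\<close>.\<close>
      have "pn (P (B - A) x) \<le> convexity_const * t powr p * (D * pn (sum b (A - B)))"
        unfolding proj_def
      proof (rule pn_sum_bounded_coeffs[OF _ _ t_ge])
        fix A' assume "A' \<subseteq> B - A"
        then have "finite A'" "card A' \<le> card (A - B)"
          using B(1) card card_mono[of "B - A" A'] finite_subset[of A' "B - A"] by auto
        then show "pn (sum b A') \<le> D * pn (sum b (A - B))"
          using finA by (intro dem) auto
      qed (use B in auto)
      also have "\<dots> = convexity_const * D * (t powr p * pn (sum b (A - B)))"
        by (simp add: mult_ac)
      also have "t powr p * pn (sum b (A - B)) \<le>
          t powr p * (C1 * pn (lincomb (\<lambda>n. sgn (b' n x)) (A - B)))"
      proof (intro mult_left_mono C1(2)[rule_format])
        fix n assume "n \<in> A - B"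
        then show "norm (sgn (b' n x)) = 1" using t_le[of n] t by (auto simp: norm_sgn)
      qed (use finA in auto)
      also have "\<dots> \<le> C1 * (C2 * pn (P (A - B) y))"
        using C2(2)[rule_format, of "A - B" t "\<lambda>n. b' n x"] finA t t_le C1(1) by (simp add: proj_y mult.left_commute)
      also have "\<dots> \<le> C1 * (C2 * ((1 + Q) * pn y))"
        using C1(1) C2(1) by (intro mult_left_mono pn_greedy_proj greedy_y) auto
      finally show ?thesis
        using D convexity_const_pos by (simp add: E_def mult_ac)
    qed
    then show ?thesis
      using split quasi_greedy_bound[OF greedy_y] by (simp add: distrib_right y_def)
  qed
  then show ?thesis
    unfolding almost_greedy_on_iff using E Q_nonneg by (intro exI[of _ "Q + E"]) auto
qed

end

section \<open>Approximation by vectors with distinct moduli\<close>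

context bounded_biorthogonal_system
begin

lemma norm_coord_less:
  assumes "pn x < s powr p" "s > 0"
  shows "norm (b' n x) < c * s"
proof -
  have "nrm x < s"
    using powr_mono2[of p s "nrm x"] assms p_pos unfolding pn_def by force
  then have "c * nrm x < c * s" using c_pos by simp
  then show ?thesis using coord_bound[of n x] by linarith
qed

text \<open>
  Approximate \<open>x\<close> in the span, raise the moduli of the coefficients in \<open>A\<close> by a bit more than twice
  the error of approximation, so that \<open>A\<close> is still greedy, then separate the moduli by an arbitrarily
  small perturbation. As \<open>A\<close> is known before the approximation, all changes are small.
\<close>

lemma distinct_moduli_approx:
  assumes dense: "\<And>e. 0 < e \<Longrightarrow> \<exists>y\<in>span (range b). pn (x - y) < e"
    and A: "greedy_set b' x A" and \<eta>: "0 < \<eta>"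
  obtains z where "z \<in> distinct_moduli b'" "greedy_set b' z A" "pn (x - z) < \<eta>"
proof -
  have finA: "finite A" using A by (simp add: greedy_set_def)
  \<comment> \<open>Changing the coefficients on \<open>A\<close> by at most \<open>\<tau>\<close>
    costs less than \<open>\<eta> / 3\<close>; a third of \<open>\<tau>\<close> is reserved for
    \<open>\<theta>\<close>, the bound on the coordinate error of the approximation.\<close>
  obtain \<tau> where \<tau>: "\<tau> > 0" "real (card A) * c powr p * \<tau> powr p < \<eta> / 3"
    using exists_powr_less[OF p_pos, of "real (card A) * c powr p" "\<eta> / 3"] \<eta> by auto
  define s where "s = \<tau> / (3 * c)"
  have s: "s > 0" using \<tau>(1) c_pos by (simp add: s_def)
  obtain y where y: "y \<in> span (range b)" "pn (x - y) < min (\<eta> / 3) (s powr p)"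
    using dense[of "min (\<eta> / 3) (s powr p)"] \<eta> s by auto
  define \<theta> where "\<theta> = \<tau> / 3"
  have \<theta>: "\<theta> > 0" using \<tau>(1) by (simp add: \<theta>_def)
  have close: "norm (b' n x - b' n y) \<le> \<theta>" for n
    using norm_coord_less[of "x - y" s n] y(2) s c_pos by (simp add: coord_diff \<theta>_def s_def)
  obtain F0 where F0: "finite F0" "\<And>F. finite F \<Longrightarrow> F0 \<subseteq> F \<Longrightarrow> y = P F y"
    using span_eq_proj[OF y(1)] by blast
  define F where "F = A \<union> F0"
  have F: "finite F" "A \<subseteq> F" "y = P F y"
    using finA F0 by (auto simp: F_def)
  have y_0: "b' n y = 0" if "n \<notin> F" for n
    using coord_proj[OF F(1), of n y] that F(3) by simp
  \<comment> \<open>This bound depends on \<open>card F\<close> and can be chosen only after the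
    approximant \<open>y\<close> is known.\<close>
  obtain \<epsilon>0 where \<epsilon>0: "\<epsilon>0 > 0" "real (card F) * c powr p * \<epsilon>0 powr p < \<eta> / 3"
    using exists_powr_less[OF p_pos, of "real (card F) * c powr p" "\<eta> / 3"] \<eta> by auto
  define \<epsilon> where "\<epsilon> = min \<epsilon>0 (\<theta> / 2)"
  have \<epsilon>: "\<epsilon> > 0" "\<epsilon> \<le> \<epsilon>0" "\<epsilon> \<le> \<theta> / 2" using \<epsilon>0(1) \<theta> by (auto simp: \<epsilon>_def)
  \<comment> \<open>The term \<open>2 * \<theta>\<close> pays for passing from \<open>y\<close> to
    \<open>x\<close> at an index outside \<open>A\<close> and back at one in \<open>A\<close>;
    \<open>\<epsilon>\<close> pays for the perturbation outside \<open>A\<close>.\<close>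
  define v where "v n = norm (b' n y) + (if n \<in> A then 2 * \<theta> + \<epsilon> else 0)" for n
  obtain w where w: "inj_on w F" "\<And>n. n \<in> F \<Longrightarrow> v n < w n" "\<And>n. n \<in> F \<Longrightarrow> w n \<le> v n + \<epsilon>"
    using injective_perturbation[OF F(1) \<epsilon>(1), of v] by auto
  \<comment> \<open>The default phase 1 at vanishing coordinates keeps \<open>u\<close> unimodular,
    so that a positive modulus can be assigned there too.\<close>
  define u where "u n = (if b' n y = 0 then 1 else sgn (b' n y))" for n
  have u: "norm (u n) = 1" "b' n y = of_real (norm (b' n y)) * u n" for n
    by (simp add: u_def norm_sgn) (simp add: u_def sgn_div_norm scaleR_conv_of_real)
  define d where "d n = of_real (w n - norm (b' n y)) * u n" for n
  have v_ge: "norm (b' n y) \<le> v n" for n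
    using \<theta> \<epsilon>(1) by (simp add: v_def)
  define z where "z = y + lincomb d F"
  have coord_z: "b' n z = (if n \<in> F then of_real (w n) * u n else 0)" for n
  proof (cases "n \<in> F")
    case True
    have "b' n z = of_real (norm (b' n y)) * u n + d n"
      using True F(1) by (simp add: z_def coord_add coord_lincomb flip: u(2))
    also have "\<dots> = of_real (w n) * u n"
      by (simp add: d_def left_diff_distrib)
    finally show ?thesis using True by simp
  next
    case False
    then show ?thesis using F(1) by (simp add: z_def coord_add coord_lincomb y_0)
  qed
  have norm_z: "norm (b' n z) = (if n \<in> F then w n else 0)" for n
    using v_ge[of n] w(2)[of n] norm_ge_zero[of "b' n y"]
    by (auto simp: coord_z norm_mult u(1) simp del: norm_ge_zero)
  show ?thesis
  proof
    have "n \<in> F" if "b' n z \<noteq> 0" for n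
      using that by (simp add: coord_z split: if_splits)
    then show "z \<in> distinct_moduli b'"
      using w(1) by (auto simp: distinct_moduli_def supp_def norm_z inj_on_def)
  next
    show "greedy_set b' z A"
      unfolding greedy_set_def
    proof (intro conjI ballI allI impI finA)
      fix n m assume n: "n \<in> A" and m: "m \<notin> A"
      have "norm (b' m z) \<le> norm (b' m y) + \<epsilon>"
        using w(3)[of m] m \<epsilon>(1) by (auto simp: norm_z v_def add_nonneg_nonneg)
      also have "\<dots> \<le> norm (b' m x) + \<theta> + \<epsilon>"
        using close[of m] norm_triangle_ineq3[of "b' m x" "b' m y"] by linarith
      also have "\<dots> \<le> norm (b' n x) + \<theta> + \<epsilon>"
        using A n m by (simp add: greedy_set_def)
      also have "\<dots> \<le> norm (b' n y) + 2 * \<theta> + \<epsilon>"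
        using close[of n] norm_triangle_ineq3[of "b' n x" "b' n y"] by linarith
      also have "\<dots> \<le> norm (b' n z)"
        using w(2)[of n] n F(2) by (auto simp: norm_z v_def)
      finally show "norm (b' m z) \<le> norm (b' n z)" .
    qed
  next
    have d_norm: "norm (d n) = w n - norm (b' n y)" if "n \<in> F" for n
      using v_ge[of n] w(2)[OF that] by (simp add: d_def norm_mult u(1) del: of_real_diff)
    \<comment> \<open>The change is at most \<open>2 * \<theta> + 2 * \<epsilon>\<close>, and
      \<open>\<epsilon> \<le> \<theta> / 2\<close> gives
      \<open>3 * \<theta> = \<tau>\<close>.\<close>
    have "norm (d n) \<le> \<tau>" if "n \<in> A" for n
      using d_norm[of n] w(3)[of n] that F(2) \<epsilon>(3) \<theta> by (auto simp: v_def \<theta>_def)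
    then have dA: "pn (lincomb d A) < \<eta> / 3"
      using pn_lincomb_le[of A d \<tau>] \<tau>(2) by auto
    have "norm (d n) \<le> \<epsilon>0" if "n \<in> F - A" for n
      using d_norm[of n] w(3)[of n] that \<epsilon>(2) by (auto simp: v_def)
    then have "pn (lincomb d (F - A)) \<le> real (card (F - A)) * c powr p * \<epsilon>0 powr p"
      by (rule pn_lincomb_le)
    also have "\<dots> \<le> real (card F) * c powr p * \<epsilon>0 powr p"
      using F(1) by (intro mult_right_mono) (auto intro: card_mono)
    finally have dF: "pn (lincomb d (F - A)) < \<eta> / 3" using \<epsilon>0(2) by simp
    have "x - z = (x - y) - (lincomb d (F - A) + lincomb d A)"
      using sum.subset_diff[OF F(2,1), of "\<lambda>n. smul (d n) (b n)"] by (simp add: z_def)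
    then have x_z: "pn (x - z) = pn ((x - y) - (lincomb d (F - A) + lincomb d A))"
      by (rule arg_cong)
    have "pn (x - z) \<le> pn (x - y) + (pn (lincomb d (F - A)) + pn (lincomb d A))"
      unfolding x_z by (intro order.trans[OF pn_diff] add_left_mono pn_add)
    then show "pn (x - z) < \<eta>" using y(2) dA dF by simp
  qed
qed

lemma almost_greedy_of_distinct_moduli:
  assumes dense: "\<And>x e. 0 < e \<Longrightarrow> \<exists>y\<in>span (range b). pn (x - y) < e"
    and "almost_greedy_on (distinct_moduli b') smul nrm b b'"
  shows "almost_greedy smul nrm b b'"
proof -
  obtain C where C: "C > 0" and le: "\<And>x A B. x \<in> distinct_moduli b' \<Longrightarrow> greedy_set b' x A \<Longrightarrow>
      finite B \<Longrightarrow> card B \<le> card A \<Longrightarrow> pn (x - P A x) \<le> C * pn (x - P B x)"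
    using assms(2) unfolding almost_greedy_on_iff by blast
  have "pn (x - P A x) \<le> C * pn (x - P B x)"
    if A: "greedy_set b' x A" and B: "finite B" "card B \<le> card A" for x A B
  proof (rule field_le_epsilon)
    fix e :: real assume e: "e > 0"
    \<comment> \<open>A Lipschitz constant for removing the projection onto \<open>D\<close>,
      measured by \<open>pn\<close>.\<close>
    define M where "M D = 1 + real (card D) * c powr p * c powr p" for D :: "nat set"
    have M: "M D > 0" for D by (simp add: M_def add_pos_nonneg)
    have cont: "pn (u - P D u) \<le> M D * pn u" for D u
      using pn_diff[of u "P D u"] pn_proj_le[of D u] by (simp add: M_def distrib_right)
    have transfer: "pn (u - P D u) \<le> pn (u' - P D u') + M D * pn (u - u')" for D u u'
    proof -
      have "u - P D u = (u' - P D u') + ((u - u') - P D (u - u'))"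
        by (simp add: proj_diff)
      then have "pn (u - P D u) \<le> pn (u' - P D u') + pn ((u - u') - P D (u - u'))"
        by (simp only: pn_add)
      then show ?thesis using cont[of "u - u'" D] by linarith
    qed
    \<comment> \<open>Passing from \<open>x\<close> to \<open>z\<close> costs \<open>M A\<close> on
      the left and \<open>C * M B\<close> on the right, so an approximation within
      \<open>e / L\<close> suffices. The constant \<open>C\<close> itself is unchanged.\<close>
    define L where "L = M A + C * M B"
    have L: "L > 0" using M C by (simp add: L_def add_pos_pos)
    obtain z where z: "z \<in> distinct_moduli b'" "greedy_set b' z A" "pn (x - z) < e / L"
      using distinct_moduli_approx[OF dense A, of "e / L"] e L by auto
    have "pn (x - P A x) \<le> pn (z - P A z) + M A * pn (x - z)"
      by (rule transfer)
    also have "pn (z - P A z) \<le> C * pn (z - P B z)"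
      using le z B by blast
    also have "\<dots> \<le> C * (pn (x - P B x) + M B * pn (x - z))"
      using transfer[of z B x] C by (simp add: pn_minus_commute[of z x])
    finally have "pn (x - P A x) \<le> C * pn (x - P B x) + L * pn (x - z)"
      by (simp add: L_def algebra_simps)
    also have "L * pn (x - z) \<le> e"
      using z(3) L by (simp add: field_simps)
    finally show "pn (x - P A x) \<le> C * pn (x - P B x) + e" by simp
  qed
  then show ?thesis
    unfolding almost_greedy_on_iff using C by (intro exI[of _ C]) auto
qed

end

section \<open>From the dual norm and the basis hypotheses to the bounded system\<close>

lemma (in p_banach_space) dual_space_bound:
  assumes "f \<in> dual_space smul p nrm"
  shows "norm (f x) \<le> dual_norm nrm f * nrm x"
proof -
  have lin: "f (smul a x) = a * f x" for a x
    using assms by (simp add: dual_space_def Vector_Spaces.linear_iff)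
  have f0: "f 0 = 0" using lin[of 0 0] by simp
  have "continuous_map mtopology euclidean f"
    using assms by (simp add: dual_space_def p_topology_def)
  then have "openin mtopology {x \<in> topspace mtopology. f x \<in> ball 0 1}"
    by (rule openin_continuous_map_preimage) simp
  then have "openin mtopology {x. norm (f x) < 1}"
    by (simp add: dist_norm)
  moreover have "0 \<in> {x. norm (f x) < 1}" using f0 by simp
  ultimately obtain r where r: "r > 0" "mball 0 r \<subseteq> {x. norm (f x) < 1}"
    unfolding openin_mtopology by meson
  have small: "norm (f x) < 1" if "nrm x powr p < r" for x
  proof -
    have "nrm (- x) = nrm x" using nrm_scale[of "- 1" x] by (simp add: scale_minus_left)
    then have "x \<in> mball 0 r" using that by (simp add: p_dist_def)
    then show ?thesis using r(2) by blast
  qed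
  \<comment> \<open>The metric is a p-th power, so scaling the unit ball by this \<open>s\<close>
    puts it strictly inside the ball of radius \<open>r\<close>.\<close>
  define s where "s = (r / 2) powr (1 / p)"
  have s: "s > 0" "s powr p = r / 2" using r(1) p_pos by (simp_all add: s_def powr_powr)
  have ball: "norm (f x) \<le> 1 / s" if "nrm x \<le> 1" for x
  proof -
    have "(s * nrm x) powr p \<le> s powr p"
      using s(1) that p_pos by (intro powr_mono2) (auto simp: nrm_nonneg mult_left_le)
    then have "nrm (smul (of_real s) x) powr p < r"
      using s r(1) by (simp add: nrm_scale)
    from small[OF this] show ?thesis
      using s(1) by (simp add: lin norm_mult field_simps)
  qed
  \<comment> \<open>Only with this bound is the real supremum \<open>dual_norm nrm f\<close> an
    upper bound for the values of \<open>f\<close> on the unit ball.\<close>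
  then have bdd: "bdd_above ((\<lambda>x. norm (f x)) ` {x. nrm x \<le> 1})"
    by (intro bdd_aboveI2) auto
  show ?thesis
  proof (cases "x = 0")
    case True
    then show ?thesis using nrm_eq_0_iff[of 0] by (simp add: f0)
  next
    case False
    then have x: "nrm x > 0" using nrm_eq_0_iff[of x] nrm_nonneg[of x] by linarith
    have "norm (f (smul (of_real (1 / nrm x)) x)) \<le> dual_norm nrm f"
      unfolding dual_norm_def
      by (intro cSUP_upper bdd) (use x in \<open>simp add: nrm_scale norm_divide\<close>)
    then show ?thesis using x by (simp add: lin norm_mult norm_divide field_simps)
  qed
qed

lemma (in p_banach_space) bounded_biorthogonal_system_of_markushevich:
  assumes basis: "markushevich_basis smul p nrm b b'" and "semi_normalized nrm b b'"
  obtains c where "bounded_biorthogonal_system smul p nrm b b' c"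
proof -
  obtain c1 c2 where c: "0 < c1"
    "\<And>n. c1 \<le> min (nrm (b n)) (dual_norm nrm (b' n)) \<and>
         max (nrm (b n)) (dual_norm nrm (b' n)) \<le> c2"
    using assms(2) unfolding semi_normalized_def by blast
  have dual: "b' n \<in> dual_space smul p nrm" for n
    using basis by (simp add: markushevich_basis_def)
  then have lin: "Vector_Spaces.linear smul (*) (b' n)" for n
    by (simp add: dual_space_def)
  have "bounded_biorthogonal_system smul p nrm b b' c2"
  proof unfold_locales
    show "0 < c2" using c(1) c(2)[of 0] by linarith
    show "b' n (x + y) = b' n x + b' n y" for n x y
      using lin by (simp add: Vector_Spaces.linear_iff)
    show "b' n (smul a x) = a * b' n x" for n a x
      using lin by (simp add: Vector_Spaces.linear_iff)
    show "b' n (b m) = (if n = m then 1 else 0)" for n m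
      using basis by (simp add: markushevich_basis_def)
    show "norm (b' n x) \<le> c2 * nrm x" for n x
      using dual_space_bound[OF dual, of n x] c(2)[of n] nrm_nonneg[of x]
      by (meson max.bounded_iff mult_right_mono order.trans)
    show "nrm (b n) \<le> c2" for n
      using c(2)[of n] by simp
  qed
  then show ?thesis by (rule that)
qed

lemma (in p_banach_space) markushevich_basis_dense:
  assumes "markushevich_basis smul p nrm b b'" "0 < e"
  shows "\<exists>y\<in>span (range b). pn (x - y) < e"
proof -
  have "x \<in> mtopology closure_of span (range b)"
    using assms(1) by (simp add: markushevich_basis_def p_topology_def)
  then show ?thesis
    using assms(2) unfolding metric_closure_of by (auto simp: p_dist_def pn_def)
qed

theorem theorem4p12:
  fixes p :: real
    and smul :: "'k::real_or_complex \<Rightarrow> 'x::ab_group_add \<Rightarrow> 'x"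
    and nrm :: "'x \<Rightarrow> real"
    and b :: "nat \<Rightarrow> 'x"
    and b' :: "nat \<Rightarrow> 'x \<Rightarrow> 'k"
  assumes "0 < p" and "p \<le> 1"
    and "p_banach_space smul p nrm"
    and "markushevich_basis smul p nrm b b'"
    and "semi_normalized nrm b b'"
  shows "(almost_greedy smul nrm b b' \<longleftrightarrow> almost_greedy_on (distinct_moduli b') smul nrm b b') \<and>
         (almost_greedy smul nrm b b' \<longleftrightarrow> quasi_greedy smul nrm b b' \<and> democratic nrm b)"
proof -
  interpret p_banach_space smul p nrm by fact
  obtain c where "bounded_biorthogonal_system smul p nrm b b' c"
    using bounded_biorthogonal_system_of_markushevich[OF assms(4,5)] .
  then interpret bounded_biorthogonal_system smul p nrm b b' c .
  show ?thesis
  proof (intro conjI iffI)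
    assume "almost_greedy smul nrm b b'"
    then show "almost_greedy_on (distinct_moduli b') smul nrm b b'"
      unfolding almost_greedy_on_def by blast
  next
    assume "almost_greedy_on (distinct_moduli b') smul nrm b b'"
    with markushevich_basis_dense[OF assms(4)] show "almost_greedy smul nrm b b'"
      by (rule almost_greedy_of_distinct_moduli)
  next
    assume "quasi_greedy smul nrm b b' \<and> democratic nrm b"
    then have qg: "quasi_greedy smul nrm b b'" and dem: "democratic nrm b"
      by simp_all
    obtain Q where Q: "Q > 0" "\<forall>x A. greedy_set b' x A \<longrightarrow> pn (x - P A x) \<le> Q * pn x"
      using qg unfolding quasi_greedy_iff by blast
    interpret quasi_greedy_system smul p nrm b b' c Q
      by unfold_locales (use Q in simp_all)
    show "almost_greedy smul nrm b b'"
      using dem by (rule almost_greedy_of_democratic)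
  qed (rule quasi_greedy_of_almost_greedy democratic_of_almost_greedy, assumption)+
qed

end
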